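(* Let $n\ge1$ and $1\le k\le n$. (1) For every fixed persistence diagram $D=\{(a_i,b_i)\}_{i=1}^n$, the $k$th persistence landscape function $t\mapsto\lambda_k(t)$ of $D$ is a tropical rational function in the one variable $t$. (2) For every fixed $t\in\mathbb{R}$, the value $\lambda_{k,t}(a_1,b_1,\dots,a_n,b_n):=\lambda_k(t)$ of the $k$th persistence landscape function of the diagram $\{(a_i,b_i)\}_{i=1}^n$, regarded as a function of the variables $a_1,b_1,\dots,a_n,b_n$ (with $a_i<b_i$ for all $i$), is a 2-symmetric tropical rational function in these variables.
   Context: A persistence diagram is a finite multiset $\{(a_i,b_i)\}_{i=1}^n$ of points with $-\infty<a_i<b_i<\infty$. For $a<b$ let $f_{(a,b)}(t)=\max(0,\min(t-a,b-t))$. The $k$th persistence landscape function $\lambda_k(t)$ of the diagram is the $k$th largest element (with multiplicity) of $\{f_{(a_i,b_i)}(t)\}_{i=1}^n$. Max-plus algebra: the semiring $\mathbb{R}\cup\{-\infty\}$ with $x\oplus y=\max(x,y)$ and $x\odot y=x+y$. A max-plus monomial in variables $x_1,\dots,x_m$ is a $\odot$-product of these variables with repetition allowed, i.e. a function $c_1x_1+\dots+c_mx_m$ with $c_i$ nonnegative integers. A tropical (max-plus) polynomial is a finite max-plus linear combination of such monomials, i.e. a finite maximum of functions of the form (constant) $+$ (monomial). A tropical rational function is a quotient $p\odot q^{-1}$, i.e. $p-q$ in ordinary notation, with $p,q$ tropical polynomials. A function of $(a_1,b_1,\dots,a_n,b_n)$ is 2-symmetric if it is invariant under the action of the symmetric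 group $S_n$ permuting the pairs $(a_i,b_i)$. *)

theory Defs
  imports Complex_Main "HOL-Library.Multiset" "HOL-Combinatorics.Permutations"
begin

definition persistence_diagram :: "(real \<times> real) multiset \<Rightarrow> bool" where
  "persistence_diagram D \<longleftrightarrow> (\<forall>(a, b) \<in># D. a < b)"

definition tent :: "real \<times> real \<Rightarrow> real \<Rightarrow> real" where
  "tent = (\<lambda>(a, b) t. max 0 (min (t - a) (b - t)))"

text \<open>Counted from 1 and with multiplicity; only meaningful for \<open>1 \<le> k \<le> size M\<close>.\<close>

definition kth_largest :: "nat \<Rightarrow> 'a::linorder multiset \<Rightarrow> 'a" where
  "kth_largest k M = rev (sorted_list_of_multiset M) ! (k - 1)"

definition landscape :: "(real \<times> real) multiset \<Rightarrow> nat \<Rightarrow> real \<Rightarrow> real" where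
  "landscape D k t = kth_largest k (image_mset (\<lambda>p. tent p t) D)"

text \<open>
  A point with \<open>m\<close> real coordinates is a function \<open>x :: nat \<Rightarrow> real\<close> of which only
  \<open>x 0, \<dots>, x (m - 1)\<close> are used.
\<close>

definition maxplus_monomial :: "nat \<Rightarrow> (nat \<Rightarrow> nat) \<Rightarrow> (nat \<Rightarrow> real) \<Rightarrow> real" where
  "maxplus_monomial m e x = (\<Sum>i<m. real (e i) * x i)"

text \<open>
  Terms with coefficient \<open>-\<infinity>\<close> do not contribute to a maximum and are left out, so coefficients
  are real. The set of terms is nonempty: the empty combination is the constant \<open>-\<infinity>\<close>, which
  is neither invertible nor the numerator of a real-valued quotient.
\<close>

definition tropical_polynomial :: "nat \<Rightarrow> ((nat \<Rightarrow> real) \<Rightarrow> real) \<Rightarrow> bool" where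
  "tropical_polynomial m p \<longleftrightarrow>
     (\<exists>S :: (real \<times> (nat \<Rightarrow> nat)) set. finite S \<and> S \<noteq> {} \<and>
        (\<forall>x. p x = Max ((\<lambda>(c, e). c + maxplus_monomial m e x) ` S)))"

definition tropical_rational_on ::
    "nat \<Rightarrow> (nat \<Rightarrow> real) set \<Rightarrow> ((nat \<Rightarrow> real) \<Rightarrow> real) \<Rightarrow> bool" where
  "tropical_rational_on m X f \<longleftrightarrow>
     (\<exists>p q. tropical_polynomial m p \<and> tropical_polynomial m q \<and> (\<forall>x\<in>X. f x = p x - q x))"

text \<open>
  The variables \<open>(a\<^sub>1, b\<^sub>1, \<dots>, a\<^sub>n, b\<^sub>n)\<close> are the coordinates \<open>x 0, \<dots>, x (2 * n - 1)\<close>: with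
  pairs counted from 0, the \<open>i\<close>-th pair is \<open>(x (2 * i), x (2 * i + 1))\<close>.
\<close>

definition diagram_coords :: "nat \<Rightarrow> (nat \<Rightarrow> real) set" where
  "diagram_coords n = {x. \<forall>i<n. x (2 * i) < x (2 * i + 1)}"

definition diagram_of :: "nat \<Rightarrow> (nat \<Rightarrow> real) \<Rightarrow> (real \<times> real) multiset" where
  "diagram_of n x = image_mset (\<lambda>i. (x (2 * i), x (2 * i + 1))) (mset_set {..<n})"

definition permute_pairs :: "(nat \<Rightarrow> nat) \<Rightarrow> (nat \<Rightarrow> real) \<Rightarrow> nat \<Rightarrow> real" where
  "permute_pairs \<sigma> x = (\<lambda>j. x (2 * \<sigma> (j div 2) + j mod 2))"

definition two_symmetric_on ::
    "nat \<Rightarrow> (nat \<Rightarrow> real) set \<Rightarrow> ((nat \<Rightarrow> real) \<Rightarrow> real) \<Rightarrow> bool" where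
  "two_symmetric_on n X f \<longleftrightarrow>
     (\<forall>\<sigma>. \<sigma> permutes {..<n} \<longrightarrow> (\<forall>x\<in>X. f (permute_pairs \<sigma> x) = f x))"

end

theory Submission
  imports Defs
begin

text \<open>
  Tropical rational functions contain the constants and the coordinates and are closed under sums,
  negation, maxima and hence minima, so every tent function is one. Order statistics are built from
  maxima and minima one element at a time: for \<open>1 < k \<le> |M|\<close>, the \<open>k\<close>th largest element of
  \<open>M + {x}\<close> is the maximum of the \<open>k\<close>th largest element of \<open>M\<close> and the minimum of \<open>x\<close> with the
  \<open>(k - 1)\<close>th largest element of \<open>M\<close>.
\<close>

section \<open>Closure properties of tropical polynomials\<close>

lemma tropical_polynomial_const: "tropical_polynomial m (\<lambda>_. c)"
  unfolding tropical_polynomial_def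
  by (rule exI[of _ "{(c, \<lambda>_. 0)}"]) (simp add: maxplus_monomial_def)

lemma tropical_polynomial_coord:
  assumes "i < m"
  shows "tropical_polynomial m (\<lambda>x. x i)"
proof -
  have "maxplus_monomial m (\<lambda>j. if j = i then 1 else 0) x = x i" for x
    using assms by (simp add: maxplus_monomial_def if_distrib[of real] if_distrib[of "\<lambda>c. c * x j" for j] cong: if_cong)
  then show ?thesis
    unfolding tropical_polynomial_def
    by (intro exI[of _ "{(0, \<lambda>j. if j = i then 1 else 0)}"]) simp
qed

lemma tropical_polynomial_max:
  assumes "tropical_polynomial m p" and "tropical_polynomial m q"
  shows "tropical_polynomial m (\<lambda>x. max (p x) (q x))"
proof -
  obtain S where S: "finite S" "S \<noteq> {}"
    "\<And>x. p x = Max ((\<lambda>(c, e). c + maxplus_monomial m e x) ` S)"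
    using assms(1) unfolding tropical_polynomial_def by blast
  obtain T where T: "finite T" "T \<noteq> {}"
    "\<And>x. q x = Max ((\<lambda>(c, e). c + maxplus_monomial m e x) ` T)"
    using assms(2) unfolding tropical_polynomial_def by blast
  show ?thesis
    unfolding tropical_polynomial_def
    by (rule exI[of _ "S \<union> T"]) (simp add: S T image_Un Max_Un)
qed

text \<open>Addition distributes over maxima, so a sum of two finite maxima is the maximum over all
  pairs of terms.\<close>

lemma tropical_polynomial_add:
  assumes "tropical_polynomial m p" and "tropical_polynomial m q"
  shows "tropical_polynomial m (\<lambda>x. p x + q x)"
proof -
  define v where "v x = (\<lambda>(c, e). c + maxplus_monomial m e x)" for x
  obtain S where S: "finite S" "S \<noteq> {}" "\<And>x. p x = Max (v x ` S)"
    using assms(1) unfolding tropical_polynomial_def v_def by blast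
  obtain T where T: "finite T" "T \<noteq> {}" "\<And>x. q x = Max (v x ` T)"
    using assms(2) unfolding tropical_polynomial_def v_def by blast
  \<comment> \<open>The tropical product of two terms: coefficients and exponents add, so that
    evaluation \<open>v x\<close> turns \<open>mul\<close> into ordinary addition.\<close>
  define mul :: "real \<times> (nat \<Rightarrow> nat) \<Rightarrow> real \<times> (nat \<Rightarrow> nat) \<Rightarrow> real \<times> (nat \<Rightarrow> nat)"
    where "mul s t = (fst s + fst t, \<lambda>i. snd s i + snd t i)" for s t
  have mul: "v x (mul s t) = v x s + v x t" for x s t
    by (simp add: v_def mul_def maxplus_monomial_def case_prod_beta algebra_simps sum.distrib)
  define R where "R = case_prod mul ` (S \<times> T)"
  have R: "finite R" "R \<noteq> {}"
    using S T by (auto simp: R_def)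
  have "p x + q x = Max (v x ` R)" for x
  proof (rule sym, rule Max_eqI)
    show "finite (v x ` R)"
      using R by simp
  next
    fix y assume "y \<in> v x ` R"
    then obtain s t where "s \<in> S" "t \<in> T" "y = v x s + v x t"
      by (auto simp: R_def mul simp del: split_paired_Ex)
    then show "y \<le> p x + q x"
      using S T by (auto intro!: add_mono Max_ge)
  next
    \<comment> \<open>Both maxima are attained; the product of two maximizing terms attains the
      upper bound.\<close>
    have "p x \<in> v x ` S" and "q x \<in> v x ` T"
      unfolding S(3) T(3) by (rule Max_in; use S T in simp)+
    then obtain s t where st: "s \<in> S" "t \<in> T" "p x = v x s" "q x = v x t"
      by blast
    then have "mul s t \<in> R"
      unfolding R_def by auto
    then show "p x + q x \<in> v x ` R"
      using st(3,4) mul by (metis image_eqI)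
  qed
  with R show ?thesis
    unfolding tropical_polynomial_def v_def by blast
qed

section \<open>Closure properties of tropical rational functions\<close>

lemma tropical_rational_onI:
  assumes "tropical_polynomial m p" and "tropical_polynomial m q"
    and "\<And>x. x \<in> X \<Longrightarrow> f x = p x - q x"
  shows "tropical_rational_on m X f"
  using assms unfolding tropical_rational_on_def by blast

lemma tropical_rational_onE:
  assumes "tropical_rational_on m X f"
  obtains p q where "tropical_polynomial m p" and "tropical_polynomial m q"
    and "\<forall>x\<in>X. f x = p x - q x"
  using assms unfolding tropical_rational_on_def by blast

lemma tropical_rational_on_polynomial:
  assumes "tropical_polynomial m p"
  shows "tropical_rational_on m X p"
  using assms tropical_polynomial_const[of m 0] by (rule tropical_rational_onI) simp

lemmas tropical_rational_on_const =
  tropical_rational_on_polynomial[OF tropical_polynomial_const]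

lemmas tropical_rational_on_coord =
  tropical_rational_on_polynomial[OF tropical_polynomial_coord]

lemma tropical_rational_on_uminus:
  assumes "tropical_rational_on m X f"
  shows "tropical_rational_on m X (\<lambda>x. - f x)"
  using assms
proof (rule tropical_rational_onE)
  fix p q
  assume "tropical_polynomial m p" "tropical_polynomial m q" "\<forall>x\<in>X. f x = p x - q x"
  then show ?thesis
    \<comment> \<open>Negation exchanges numerator and denominator.\<close>
    by (intro tropical_rational_onI[of m q p]) auto
qed

lemma tropical_rational_on_add:
  assumes "tropical_rational_on m X f" and "tropical_rational_on m X g"
  shows "tropical_rational_on m X (\<lambda>x. f x + g x)"
proof -
  obtain p q where pq: "tropical_polynomial m p" "tropical_polynomial m q"
      "\<forall>x\<in>X. f x = p x - q x"
    using assms(1) by (rule tropical_rational_onE)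
  obtain p' q' where pq': "tropical_polynomial m p'" "tropical_polynomial m q'"
      "\<forall>x\<in>X. g x = p' x - q' x"
    using assms(2) by (rule tropical_rational_onE)
  show ?thesis
  proof (rule tropical_rational_onI)
    show "tropical_polynomial m (\<lambda>x. p x + p' x)" "tropical_polynomial m (\<lambda>x. q x + q' x)"
      by (intro tropical_polynomial_add pq pq')+
    show "f x + g x = (p x + p' x) - (q x + q' x)" if "x \<in> X" for x
      using pq(3) pq'(3) that by simp
  qed
qed

lemma tropical_rational_on_diff:
  assumes "tropical_rational_on m X f" and "tropical_rational_on m X g"
  shows "tropical_rational_on m X (\<lambda>x. f x - g x)"
  using tropical_rational_on_add[OF assms(1) tropical_rational_on_uminus[OF assms(2)]] by simp

text \<open>Bring both quotients to the common denominator \<open>q + q'\<close>; subtracting it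
  commutes with the maximum.\<close>

lemma tropical_rational_on_max:
  assumes "tropical_rational_on m X f" and "tropical_rational_on m X g"
  shows "tropical_rational_on m X (\<lambda>x. max (f x) (g x))"
proof -
  obtain p q where pq: "tropical_polynomial m p" "tropical_polynomial m q"
      "\<forall>x\<in>X. f x = p x - q x"
    using assms(1) by (rule tropical_rational_onE)
  obtain p' q' where pq': "tropical_polynomial m p'" "tropical_polynomial m q'"
      "\<forall>x\<in>X. g x = p' x - q' x"
    using assms(2) by (rule tropical_rational_onE)
  show ?thesis
  proof (rule tropical_rational_onI)
    show "tropical_polynomial m (\<lambda>x. max (p x + q' x) (p' x + q x))"
      "tropical_polynomial m (\<lambda>x. q x + q' x)"
      by (intro tropical_polynomial_max tropical_polynomial_add pq pq')+
    show "max (f x) (g x) = max (p x + q' x) (p' x + q x) - (q x + q' x)" if "x \<in> X" for x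
      using pq(3) pq'(3) that by (simp add: max_def)
  qed
qed

lemma tropical_rational_on_min:
  assumes "tropical_rational_on m X f" and "tropical_rational_on m X g"
  shows "tropical_rational_on m X (\<lambda>x. min (f x) (g x))"
proof -
  have "(\<lambda>x. min (f x) (g x)) = (\<lambda>x. - max (- f x) (- g x))"
    by (auto simp: max_def min_def)
  then show ?thesis
    using assms by (simp add: tropical_rational_on_uminus tropical_rational_on_max)
qed

text \<open>Endpoints and argument are all arbitrary functions of the variables, to serve both a
  fixed diagram with variable \<open>t\<close> and a fixed \<open>t\<close> with variable
  endpoints.\<close>

lemma tropical_rational_on_tent:
  assumes "tropical_rational_on m X a" and "tropical_rational_on m X b"
    and "tropical_rational_on m X t"
  shows "tropical_rational_on m X (\<lambda>x. tent (a x, b x) (t x))"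
  unfolding tent_def prod.case
  by (intro tropical_rational_on_max tropical_rational_on_min tropical_rational_on_diff
      tropical_rational_on_const assms)

section \<open>Order statistics by counting\<close>

text \<open>In a decreasing list the entries that are at least \<open>c\<close> form an initial
  segment, so position \<open>j\<close> belongs to it exactly when its length exceeds
  \<open>j\<close>.\<close>

lemma le_nth_iff_length_filter:
  fixes xs :: "'a::linorder list"
  assumes "sorted_wrt (\<ge>) xs" and "j < length xs"
  shows "c \<le> xs ! j \<longleftrightarrow> j < length (filter (\<lambda>y. c \<le> y) xs)"
  using assms
proof (induction xs arbitrary: j)
  case (Cons y ys)
  have "filter (\<lambda>y. c \<le> y) ys = []" if "\<not> c \<le> y"
    using Cons.prems(1) that by (auto simp: filter_empty_conv dest: order.trans)
  with Cons show ?case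
    by (cases j) auto
qed simp

text \<open>A value is determined by its lower bounds \<open>c\<close>, so this criterion reduces
  identities between order statistics to counting elements that are at least
  \<open>c\<close>.\<close>

lemma le_kth_largest_iff:
  assumes "1 \<le> k" and "k \<le> size M"
  shows "c \<le> kth_largest k M \<longleftrightarrow> k \<le> size (filter_mset (\<lambda>y. c \<le> y) M)"
proof -
  let ?xs = "rev (sorted_list_of_multiset M)"
  have "length ?xs = size M"
    by (metis length_rev mset_sorted_list_of_multiset size_mset)
  moreover have "sorted_wrt (\<ge>) ?xs"
    by (simp add: sorted_wrt_rev)
  ultimately have "c \<le> ?xs ! (k - 1) \<longleftrightarrow> k - 1 < length (filter (\<lambda>y. c \<le> y) ?xs)"
    using assms by (intro le_nth_iff_length_filter) auto
  moreover have "length (filter (\<lambda>y. c \<le> y) ?xs) = size (filter_mset (\<lambda>y. c \<le> y) M)"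
    by (metis mset_filter mset_rev mset_sorted_list_of_multiset size_mset)
  ultimately show ?thesis
    using assms unfolding kth_largest_def by auto
qed

lemma kth_largest_single: "kth_largest (Suc 0) {#x#} = x"
  by (simp add: kth_largest_def)

lemma kth_largest_add_mset_first:
  assumes "M \<noteq> {#}"
  shows "kth_largest (Suc 0) (add_mset x M) = max x (kth_largest (Suc 0) M)"
proof -
  have "c \<le> kth_largest (Suc 0) (add_mset x M) \<longleftrightarrow> c \<le> max x (kth_largest (Suc 0) M)" for c
    using assms by (simp add: le_kth_largest_iff Suc_le_eq nonempty_has_size le_max_iff_disj)
  then show ?thesis
    by (meson order.antisym order.refl)
qed

lemma kth_largest_add_mset_last:
  assumes "M \<noteq> {#}"
  shows "kth_largest (Suc (size M)) (add_mset x M) = min x (kth_largest (size M) M)"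
proof -
  have "c \<le> kth_largest (Suc (size M)) (add_mset x M) \<longleftrightarrow> c \<le> min x (kth_largest (size M) M)" for c
    \<comment> \<open>At most \<open>size M\<close> elements of \<open>M\<close> are counted, so
      reaching \<open>Suc (size M)\<close> requires \<open>x\<close> and every element of
      \<open>M\<close>.\<close>
    using assms size_filter_mset_lesseq[of "\<lambda>y. c \<le> y" M, THEN leD]
    by (auto simp: le_kth_largest_iff Suc_le_eq nonempty_has_size)
  then show ?thesis
    by (meson order.antisym order.refl)
qed

text \<open>Inserting \<open>x\<close> raises the count by one exactly when
  \<open>c \<le> x\<close>. So it reaches \<open>Suc k\<close> if it did so before, or if it was at
  least \<open>k\<close> and \<open>x\<close> counts too.\<close>

lemma kth_largest_add_mset:
  assumes "1 \<le> k" and "Suc k \<le> size M"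
  shows "kth_largest (Suc k) (add_mset x M) =
    max (kth_largest (Suc k) M) (min x (kth_largest k M))"
proof -
  have "c \<le> kth_largest (Suc k) (add_mset x M) \<longleftrightarrow>
      c \<le> max (kth_largest (Suc k) M) (min x (kth_largest k M))" for c
    using assms by (auto simp: le_kth_largest_iff le_max_iff_disj)
  then show ?thesis
    by (meson order.antisym order.refl)
qed

text \<open>The index multiset \<open>A\<close> can be the diagram itself or the positions
  \<open>0, ..., n - 1\<close>. The rank \<open>k\<close> varies in the induction because the
  recursion also uses rank \<open>k - 1\<close>.\<close>

lemma tropical_rational_on_kth_largest:
  assumes "\<And>i. i \<in># A \<Longrightarrow> tropical_rational_on m X (f i)" and "1 \<le> k" and "k \<le> size A"
  shows "tropical_rational_on m X (\<lambda>x. kth_largest k (image_mset (\<lambda>i. f i x) A))"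
  using assms
proof (induction A arbitrary: k)
  case (add i A)
  let ?K = "\<lambda>k x. kth_largest k (image_mset (\<lambda>i. f i x) A)"
  have fi: "tropical_rational_on m X (f i)"
    using add.prems by simp
  have IH: "tropical_rational_on m X (?K j)" if "1 \<le> j" "j \<le> size A" for j
    using add that by simp
  \<comment> \<open>The extreme ranks are separated because rank 0, or rank
    \<open>Suc (size A)\<close> in \<open>A\<close>, would be meaningless.\<close>
  consider "A = {#}" "k = 1" | "A \<noteq> {#}" "k = 1" | "A \<noteq> {#}" "k = Suc (size A)"
    | j where "k = Suc j" "1 \<le> j" "Suc j \<le> size A"
    using add.prems(2,3) by (cases k; cases "k = Suc (size A)") force+
  then show ?case
  proof cases
    case 1
    with fi show ?thesis
      by (simp add: kth_largest_single)
  next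
    case 2
    have "tropical_rational_on m X (\<lambda>x. max (f i x) (?K 1 x))"
      using 2 by (intro tropical_rational_on_max fi IH) (auto simp: Suc_le_eq nonempty_has_size)
    with 2 show ?thesis
      by (simp add: kth_largest_add_mset_first)
  next
    case 3
    have "tropical_rational_on m X (\<lambda>x. min (f i x) (?K (size A) x))"
      using 3 by (intro tropical_rational_on_min fi IH) (auto simp: Suc_le_eq nonempty_has_size)
    moreover have "kth_largest (Suc (size A)) (add_mset (f i x) (image_mset (\<lambda>i. f i x) A)) =
        min (f i x) (?K (size A) x)" for x
      using 3 kth_largest_add_mset_last[of "image_mset (\<lambda>i. f i x) A"] by simp
    ultimately show ?thesis
      using 3 by simp
  next
    case 4
    have "tropical_rational_on m X (\<lambda>x. max (?K (Suc j) x) (min (f i x) (?K j x)))"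
      using 4 by (intro tropical_rational_on_max tropical_rational_on_min fi IH) auto
    with 4 show ?thesis
      by (simp add: kth_largest_add_mset)
  qed
qed simp

section \<open>Application to persistence landscapes\<close>

lemma diagram_of_permute_pairs:
  assumes "\<sigma> permutes {..<n}"
  shows "diagram_of n (permute_pairs \<sigma> x) = diagram_of n x"
proof -
  have "diagram_of n (permute_pairs \<sigma> x) =
      image_mset (\<lambda>i. (x (2 * i), x (2 * i + 1))) (image_mset \<sigma> (mset_set {..<n}))"
    by (simp add: diagram_of_def permute_pairs_def multiset.map_comp comp_def)
  \<comment> \<open>Permuting pairs only reindexes the diagram by \<open>\<sigma>\<close>, which
    maps \<open>{..<n}\<close> bijectively onto itself.\<close>
  also have "image_mset \<sigma> (mset_set {..<n}) = mset_set {..<n}"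
    using image_mset_mset_set[OF permutes_inj_on[OF assms]] permutes_image[OF assms] by simp
  finally show ?thesis
    by (simp add: diagram_of_def)
qed

theorem mainTheorem5:
  fixes n k :: nat
  assumes "n \<ge> 1" and "1 \<le> k" and "k \<le> n"
  shows "(\<forall>D. persistence_diagram D \<and> size D = n \<longrightarrow>
            tropical_rational_on 1 UNIV (\<lambda>x. landscape D k (x 0))) \<and>
         (\<forall>t :: real.
            two_symmetric_on n (diagram_coords n) (\<lambda>x. landscape (diagram_of n x) k t) \<and>
            tropical_rational_on (2 * n) (diagram_coords n) (\<lambda>x. landscape (diagram_of n x) k t))"
proof (intro conjI allI impI)
  fix D :: "(real \<times> real) multiset"
  assume D: "persistence_diagram D \<and> size D = n"
  have "tropical_rational_on 1 UNIV (\<lambda>x. tent p (x 0))" for p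
    using tropical_rational_on_tent[of 1 UNIV "\<lambda>_. fst p" "\<lambda>_. snd p" "\<lambda>x. x 0"]
    by (simp add: tropical_rational_on_const tropical_rational_on_coord)
  with D assms show "tropical_rational_on 1 UNIV (\<lambda>x. landscape D k (x 0))"
    unfolding landscape_def by (intro tropical_rational_on_kth_largest) auto
next
  fix t :: real
  show "two_symmetric_on n (diagram_coords n) (\<lambda>x. landscape (diagram_of n x) k t)"
    \<comment> \<open>The landscape depends on \<open>x\<close> only through the diagram, which is
      invariant.\<close>
    by (simp add: two_symmetric_on_def diagram_of_permute_pairs)
  let ?f = "\<lambda>i x. tent (x (2 * i), x (2 * i + 1)) t"
  have "tropical_rational_on (2 * n) (diagram_coords n) (?f i)" if "i < n" for i
    using that
    by (intro tropical_rational_on_tent tropical_rational_on_const tropical_rational_on_coord) auto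
  then have "tropical_rational_on (2 * n) (diagram_coords n)
      (\<lambda>x. kth_largest k (image_mset (\<lambda>i. ?f i x) (mset_set {..<n})))"
    using assms by (intro tropical_rational_on_kth_largest) auto
  then show "tropical_rational_on (2 * n) (diagram_coords n) (\<lambda>x. landscape (diagram_of n x) k t)"
    by (simp add: landscape_def diagram_of_def multiset.map_comp comp_def)
qed

end
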